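(* Let $\{\mathbf{T}^\ell\}_{\ell\in\mathbb{N}}$ be operators $\mathbf{T}^\ell:\mathbb{H}\to\mathbb{H}$ that are $\zeta$-contractive with a common constant $\zeta\in(0,1)$. Let $\bar{\mathbf{x}}^\ell$ be the unique fixed point of $\mathbf{T}^\ell$. Suppose there is $\sigma\ge 0$ with $\|\bar{\mathbf{x}}^\ell-\bar{\mathbf{x}}^{\ell-1}\|\le\sigma$ for all $\ell\geq 1$. Let $\{\mathbf{u}^\ell\}_{\ell\in\mathbb{N}}$, $\mathbf{u}^\ell=(u_1^\ell,\ldots,u_n^\ell)$, be $\{0,1\}^n$-valued random vectors with $\mathbb{P}[u_i^\ell=1]=p_i>0$ for $i\in\{1,\ldots,n\}$ (no independence among the components of $\mathbf{u}^\ell$ is required). Let $\{\mathbf{e}^\ell\}_{\ell\in\mathbb{N}}$, $\mathbf{e}^\ell=(e_1^\ell,\ldots,e_n^\ell)$, be $\mathbb{H}$-valued random vectors with $\mathbb{E}[\|\mathbf{e}^\ell\|^2]\le\nu^2$ for a constant $\nu\ge0$. Assume that each of the processes $\{\mathbf{u}^\ell\}_{\ell}$ and $\{\mathbf{e}^\ell\}_{\ell}$ is i.i.d. and that the two processes are independent of each other. Let $\mathbf{x}^0\in\mathbb{H}$ be deterministic and let $\{\mathbf{x}^\ell\}_{\ell\in\mathbb{N}}$ be generated by $$x_i^{\ell+1}=(1-u_i^\ell)\,x_i^\ell+u_i^\ell\left(\mathbf{T}_i^{\ell+1}\mathbf{x}^\ell+e_i^\ell\right),\qquad i\in\{1,\ldots,n\},\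 \ell\in\mathbb{N}.$$ Then for every $\ell\in\mathbb{N}$ $$\mathbb{E}\left[\|\mathbf{x}^\ell-\bar{\mathbf{x}}^\ell\|\right]\le\sqrt{\frac{\bar p}{\underline p}}\left(\chi^\ell\|\mathbf{x}^0-\bar{\mathbf{x}}^0\|+\frac{1-\chi^\ell}{1-\chi}(\chi\sigma+\nu)\right),$$ where $\bar p:=\max_i p_i$, $\underline p:=\min_i p_i$ and $\chi:=\sqrt{1-\underline p+\underline p\,\zeta^2}\in(0,1)$.
   Context: $\mathbb{H}=\mathbb{H}_1\oplus\cdots\oplus\mathbb{H}_n$ is a direct sum of (possibly infinite-dimensional) Hilbert spaces $\mathbb{H}_i$ with inner products $\langle\cdot,\cdot\rangle_i$ and norms $\|\cdot\|_i$. Its elements are $\mathbf{x}=(x_1,\ldots,x_n)$ with $x_i\in\mathbb{H}_i$, its inner product is $\langle\mathbf{x},\mathbf{y}\rangle=\sum_{i=1}^n\langle x_i,y_i\rangle_i$, and $\|\cdot\|$ is the induced norm. An operator on $\mathbb{H}$ is written in components as $\mathbf{T}\mathbf{x}=(\mathbf{T}_1\mathbf{x},\ldots,\mathbf{T}_n\mathbf{x})$ with $\mathbf{T}_i:\mathbb{H}\to\mathbb{H}_i$. It is $\zeta$-contractive if $\zeta\in(0,1)$ and $\|\mathbf{T}\mathbf{x}-\mathbf{T}\mathbf{y}\|\le\zeta\|\mathbf{x}-\mathbf{y}\|$ for all $\mathbf{x},\mathbf{y}\in\mathbb{H}$. A fixed point is a point $\bar{\mathbf{x}}$ with $\bar{\mathbf{x}}=\mathbf{T}\bar{\mathbf{x}}$.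 $\mathbb{N}$ includes $0$. All random variables live on one probability space $(\Omega,\mathcal{F},\mathbb{P})$. *)

theory Defs
  imports "HOL-Probability.Independent_Family"
begin

text \<open>
  The summands of the direct sum may be different Hilbert spaces. A family of Hilbert spaces
  indexed by a finite type is rendered as a family of complete linear subspaces
  \<open>H i\<close> of one inner product space, which loses no generality since
  any such family embeds isometrically into a common inner product space (e.g. its direct sum).
  On \<open>'a ^ 'n\<close> the library inner product is the sum of the componentwise
  inner products, and the norm is the induced one.
\<close>

definition hilbert_subspace :: "'a::real_inner set \<Rightarrow> bool" where
  "hilbert_subspace V \<longleftrightarrow> subspace V \<and> complete V"

definition direct_sum :: "('n \<Rightarrow> 'a set) \<Rightarrow> ('a ^ 'n::finite) set" where
  "direct_sum H = {x. \<forall>i. x $ i \<in> H i}"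

definition contractive :: "real \<Rightarrow> 'b::real_normed_vector set \<Rightarrow> ('b \<Rightarrow> 'b) \<Rightarrow> bool" where
  "contractive \<zeta> D f \<longleftrightarrow> 0 < \<zeta> \<and> \<zeta> < 1 \<and> f \<in> D \<rightarrow> D \<and>
     (\<forall>x\<in>D. \<forall>y\<in>D. norm (f x - f y) \<le> \<zeta> * norm (x - y))"

text \<open>
  Random vectors are strongly measurable maps (pointwise limits of simple functions). On a
  separable space this is Borel measurability, see below. On a nonseparable space Borel
  measurability alone is not preserved by addition, because the Borel sets of the square may
  not be generated by measurable rectangles.
\<close>

definition strongly_measurable :: "'w measure \<Rightarrow> ('w \<Rightarrow> 'b::metric_space) \<Rightarrow> bool" where
  "strongly_measurable M X \<longleftrightarrow>
     (\<exists>s :: nat \<Rightarrow> 'w \<Rightarrow> 'b. (\<forall>k. simple_function M (s k)) \<and>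
        (\<forall>\<omega>\<in>space M. (\<lambda>k. s k \<omega>) \<longlonglongrightarrow> X \<omega>))"

lemma strongly_measurable_imp_borel:
  assumes "strongly_measurable M X"
  shows "X \<in> borel_measurable M"
proof -
  obtain s :: "nat \<Rightarrow> 'a \<Rightarrow> 'b" where s: "\<And>k. simple_function M (s k)"
    and lim: "\<And>\<omega>. \<omega> \<in> space M \<Longrightarrow> (\<lambda>k. s k \<omega>) \<longlonglongrightarrow> X \<omega>"
    using assms unfolding strongly_measurable_def by blast
  show ?thesis
    by (rule borel_measurable_LIMSEQ_metric[OF borel_measurable_simple_function[OF s] lim])
qed

lemma strongly_measurable_iff_borel:
  fixes X :: "'w \<Rightarrow> 'b::{metric_space, second_countable_topology}"
  shows "strongly_measurable M X \<longleftrightarrow> X \<in> borel_measurable M"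
proof
  assume "X \<in> borel_measurable M"
  from borel_measurable_implies_sequence_metric[OF this, of undefined]
  show "strongly_measurable M X"
    unfolding strongly_measurable_def by blast
qed (rule strongly_measurable_imp_borel)

definition iid_process :: "'w measure \<Rightarrow> 'b measure \<Rightarrow> (nat \<Rightarrow> 'w \<Rightarrow> 'b) \<Rightarrow> bool" where
  "iid_process M N X \<longleftrightarrow>
     prob_space.indep_vars M (\<lambda>_. N) X UNIV \<and> (\<forall>l. distr M N (X l) = distr M N (X 0))"

text \<open>
  The \<open>\<sigma>\<close>-algebra generated by a whole process: pulling back the product
  \<open>\<sigma>\<close>-algebra on sequences gives the \<open>\<sigma>\<close>-algebra generated by all the
  \<open>X l\<close> jointly. Independence is stated with \<open>indep_set\<close> because
  \<open>indep_var\<close> requires both variables to have the same value type.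
\<close>

definition process_sigma :: "'w measure \<Rightarrow> 'b measure \<Rightarrow> (nat \<Rightarrow> 'w \<Rightarrow> 'b) \<Rightarrow> 'w measure" where
  "process_sigma M N X = vimage_algebra (space M) (\<lambda>\<omega> l. X l \<omega>) (Pi\<^sub>M UNIV (\<lambda>_::nat. N))"

definition indep_processes ::
  "'w measure \<Rightarrow> 'b measure \<Rightarrow> (nat \<Rightarrow> 'w \<Rightarrow> 'b) \<Rightarrow> 'c measure \<Rightarrow> (nat \<Rightarrow> 'w \<Rightarrow> 'c) \<Rightarrow> bool"
where
  "indep_processes M N X L Y \<longleftrightarrow>
     prob_space.indep_set M (sets (process_sigma M N X)) (sets (process_sigma M L Y))"

end

theory Submission
  imports Defs "HOL-Probability.Conditional_Expectation"
begin

text \<open>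
  In the weighted norm \<open>N y = sqrt (\<Sum>i. (norm (y $ i))\<^sup>2 / p i)\<close> a random coordinate update
  \<open>z\<close> of \<open>d\<close> towards \<open>t\<close>, with updates independent of \<open>(d, t)\<close>, satisfies
  \<open>E (N z)\<^sup>2 = E (N d)\<^sup>2 - E (norm d)\<^sup>2 + E (norm t)\<^sup>2\<close>, whatever the joint law of the coordinates.
  If \<open>norm t \<le> \<zeta> * norm d\<close>, this is at most \<open>chi\<^sup>2 * E (N d)\<^sup>2\<close> because
  \<open>norm d \<ge> sqrt pmin * N d\<close>. With \<open>d = 0\<close> and \<open>t = e\<close> the same identity bounds the
  noise contribution by \<open>\<nu>\<close> in \<open>L\<^sup>2\<close>. Minkowski's inequality in \<open>L\<^sup>2\<close> gives the recursion
  \<open>a (Suc l) = chi * (a l + \<sigma> / sqrt pmin) + \<nu>\<close> for bounds on the \<open>L\<^sup>2\<close> norm of \<open>N (x l - xbar l)\<close>.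
  The independence needed at time \<open>l\<close> is that of \<open>u l\<close> from the past of \<open>u\<close> joined with
  the whole process \<open>e\<close>.
\<close>

section \<open>Measurability in nonseparable spaces\<close>

text \<open>
  On a nonseparable space Borel measurable maps are not closed under addition. Being approximable,
  for every \<open>\<epsilon>\<close>, by a countable measurable partition with oscillation below
  \<open>\<epsilon>\<close> is a substitute for strong measurability whose closure properties do not require
  approximants with values in the domain of the operators.
\<close>

definition discretizable :: "'w measure \<Rightarrow> ('w \<Rightarrow> 'b::metric_space) \<Rightarrow> bool" where
  "discretizable G X \<longleftrightarrow> (\<forall>\<epsilon>>0. \<exists>c :: 'w \<Rightarrow> nat. c \<in> measurable G (count_space UNIV) \<and>
     (\<forall>\<omega>\<in>space G. \<forall>\<omega>'\<in>space G. c \<omega> = c \<omega>' \<longrightarrow> dist (X \<omega>) (X \<omega>') < \<epsilon>))"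

lemma discretizableE:
  assumes "discretizable G X" "\<epsilon> > 0"
  obtains c :: "'w \<Rightarrow> nat" where "c \<in> measurable G (count_space UNIV)"
    "\<And>\<omega> \<omega>'. \<omega> \<in> space G \<Longrightarrow> \<omega>' \<in> space G \<Longrightarrow> c \<omega> = c \<omega>' \<Longrightarrow> dist (X \<omega>) (X \<omega>') < \<epsilon>"
  using assms unfolding discretizable_def by blast

lemma discretizable_const: "discretizable G (\<lambda>_. a)"
  unfolding discretizable_def by (auto intro!: exI[of _ "\<lambda>_. 0"])

lemma discretizable_cong:
  assumes "discretizable G X" "\<And>\<omega>. \<omega> \<in> space G \<Longrightarrow> Y \<omega> = X \<omega>"
  shows "discretizable G Y"
  using assms unfolding discretizable_def by simp

text \<open>A partition that is fine enough for \<open>X\<close> also serves its image under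
  \<open>f\<close>. Working on a set \<open>S\<close> that contains the values of \<open>X\<close>
  admits operators that are controlled only on the direct sum.\<close>

lemma discretizable_uniformly_continuous:
  assumes X: "discretizable G X" and S: "X \<in> space G \<rightarrow> S" and f: "uniformly_continuous_on S f"
  shows "discretizable G (\<lambda>\<omega>. f (X \<omega>))"
  unfolding discretizable_def
proof (intro allI impI)
  fix \<epsilon> :: real assume "\<epsilon> > 0"
  with f obtain d where "d > 0" and d: "\<And>a b. a \<in> S \<Longrightarrow> b \<in> S \<Longrightarrow> dist a b < d \<Longrightarrow> dist (f a) (f b) < \<epsilon>"
    unfolding uniformly_continuous_on_def by metis
  obtain c :: "'a \<Rightarrow> nat" where "c \<in> measurable G (count_space UNIV)"
    and "\<And>\<omega> \<omega>'. \<omega> \<in> space G \<Longrightarrow> \<omega>' \<in> space G \<Longrightarrow> c \<omega> = c \<omega>' \<Longrightarrow> dist (X \<omega>) (X \<omega>') < d"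
    using discretizableE[OF X \<open>d > 0\<close>] by blast
  then show "\<exists>c :: 'a \<Rightarrow> nat. c \<in> measurable G (count_space UNIV) \<and>
     (\<forall>\<omega>\<in>space G. \<forall>\<omega>'\<in>space G. c \<omega> = c \<omega>' \<longrightarrow> dist (f (X \<omega>)) (f (X \<omega>')) < \<epsilon>)"
    using d S by (intro exI[of _ c]) (auto simp: Pi_iff)
qed

lemma discretizable_add:
  fixes X Y :: "'w \<Rightarrow> 'b::real_normed_vector"
  assumes X: "discretizable G X" and Y: "discretizable G Y"
  shows "discretizable G (\<lambda>\<omega>. X \<omega> + Y \<omega>)"
  unfolding discretizable_def
proof (intro allI impI)
  fix \<epsilon> :: real assume "\<epsilon> > 0"
  then have "\<epsilon> / 2 > 0" by simp
  obtain c :: "_ \<Rightarrow> nat" where [measurable]: "c \<in> measurable G (count_space UNIV)"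
    and c: "\<And>\<omega> \<omega>'. \<omega> \<in> space G \<Longrightarrow> \<omega>' \<in> space G \<Longrightarrow> c \<omega> = c \<omega>' \<Longrightarrow> dist (X \<omega>) (X \<omega>') < \<epsilon> / 2"
    using discretizableE[OF X \<open>\<epsilon> / 2 > 0\<close>] by blast
  obtain d :: "_ \<Rightarrow> nat" where [measurable]: "d \<in> measurable G (count_space UNIV)"
    and d: "\<And>\<omega> \<omega>'. \<omega> \<in> space G \<Longrightarrow> \<omega>' \<in> space G \<Longrightarrow> d \<omega> = d \<omega>' \<Longrightarrow> dist (Y \<omega>) (Y \<omega>') < \<epsilon> / 2"
    using discretizableE[OF Y \<open>\<epsilon> / 2 > 0\<close>] by blast
  \<comment> \<open>Coding the pair of cell indices passes to the common refinement of the two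
    partitions.\<close>
  have "(\<lambda>\<omega>. prod_encode (c \<omega>, d \<omega>)) \<in> measurable G (count_space UNIV)"
    by measurable
  moreover have "dist (X \<omega> + Y \<omega>) (X \<omega>' + Y \<omega>') < \<epsilon>"
    if "\<omega> \<in> space G" "\<omega>' \<in> space G" "c \<omega> = c \<omega>'" "d \<omega> = d \<omega>'" for \<omega> \<omega>'
    using c[of \<omega> \<omega>'] d[of \<omega> \<omega>'] that dist_triangle_add[of "X \<omega>" "Y \<omega>" "X \<omega>'" "Y \<omega>'"] by linarith
  ultimately show "\<exists>c :: 'w \<Rightarrow> nat. c \<in> measurable G (count_space UNIV) \<and>
     (\<forall>\<omega>\<in>space G. \<forall>\<omega>'\<in>space G. c \<omega> = c \<omega>' \<longrightarrow> dist (X \<omega> + Y \<omega>) (X \<omega>' + Y \<omega>') < \<epsilon>)"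
    by (intro exI[of _ "\<lambda>\<omega>. prod_encode (c \<omega>, d \<omega>)"]) auto
qed

lemma discretizable_if:
  assumes X: "discretizable G X" and Y: "discretizable G Y" and [measurable]: "Measurable.pred G P"
  shows "discretizable G (\<lambda>\<omega>. if P \<omega> then X \<omega> else Y \<omega>)"
  unfolding discretizable_def
proof (intro allI impI)
  fix \<epsilon> :: real assume "\<epsilon> > 0"
  obtain c :: "_ \<Rightarrow> nat" where [measurable]: "c \<in> measurable G (count_space UNIV)"
    and c: "\<And>\<omega> \<omega>'. \<omega> \<in> space G \<Longrightarrow> \<omega>' \<in> space G \<Longrightarrow> c \<omega> = c \<omega>' \<Longrightarrow> dist (X \<omega>) (X \<omega>') < \<epsilon>"
    using discretizableE[OF X \<open>\<epsilon> > 0\<close>] by blast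
  obtain d :: "_ \<Rightarrow> nat" where [measurable]: "d \<in> measurable G (count_space UNIV)"
    and d: "\<And>\<omega> \<omega>'. \<omega> \<in> space G \<Longrightarrow> \<omega>' \<in> space G \<Longrightarrow> d \<omega> = d \<omega>' \<Longrightarrow> dist (Y \<omega>) (Y \<omega>') < \<epsilon>"
    using discretizableE[OF Y \<open>\<epsilon> > 0\<close>] by blast
  \<comment> \<open>The parity of the code records the branch, so points with equal codes lie in the
    same branch and in the same cell of its partition.\<close>
  let ?b = "\<lambda>\<omega>. if P \<omega> then 2 * c \<omega> else 2 * d \<omega> + 1"
  have "?b \<in> measurable G (count_space UNIV)"
    by measurable
  moreover have "dist (if P \<omega> then X \<omega> else Y \<omega>) (if P \<omega>' then X \<omega>' else Y \<omega>') < \<epsilon>"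
    if "\<omega> \<in> space G" "\<omega>' \<in> space G" "?b \<omega> = ?b \<omega>'" for \<omega> \<omega>'
    using that c d by (auto split: if_splits) presburger+
  ultimately show "\<exists>c :: 'a \<Rightarrow> nat. c \<in> measurable G (count_space UNIV) \<and>
     (\<forall>\<omega>\<in>space G. \<forall>\<omega>'\<in>space G. c \<omega> = c \<omega>' \<longrightarrow>
        dist (if P \<omega> then X \<omega> else Y \<omega>) (if P \<omega>' then X \<omega>' else Y \<omega>') < \<epsilon>)"
    by (intro exI[of _ ?b]) blast
qed

lemma discretizable_vec:
  fixes X :: "'w \<Rightarrow> 'b::metric_space ^ 'n::finite"
  assumes X: "\<And>i. discretizable G (\<lambda>\<omega>. X \<omega> $ i)"
  shows "discretizable G X"
  unfolding discretizable_def
proof (intro allI impI)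
  fix \<epsilon> :: real assume "\<epsilon> > 0"
  \<comment> \<open>The distance of two vectors is at most the sum of the \<open>CARD('n)\<close>
    componentwise distances, so this tolerance per component adds up to
    \<open>\<epsilon>\<close>.\<close>
  define \<delta> where "\<delta> = \<epsilon> / CARD('n)"
  have "\<delta> > 0" using \<open>\<epsilon> > 0\<close> by (simp add: \<delta>_def)
  have "\<exists>c :: 'w \<Rightarrow> nat. c \<in> measurable G (count_space UNIV) \<and>
     (\<forall>\<omega>\<in>space G. \<forall>\<omega>'\<in>space G. c \<omega> = c \<omega>' \<longrightarrow> dist (X \<omega> $ i) (X \<omega>' $ i) < \<delta>)" for i
    using X[of i] \<open>\<delta> > 0\<close> unfolding discretizable_def by blast
  then obtain c :: "'n \<Rightarrow> 'w \<Rightarrow> nat" where cm[measurable]: "\<And>i. c i \<in> measurable G (count_space UNIV)"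
    and c: "\<And>i \<omega> \<omega>'. \<omega> \<in> space G \<Longrightarrow> \<omega>' \<in> space G \<Longrightarrow> c i \<omega> = c i \<omega>' \<Longrightarrow> dist (X \<omega> $ i) (X \<omega>' $ i) < \<delta>"
    by metis
  \<comment> \<open>Functions from a finite type to \<open>nat\<close> form a countable type, so
    \<open>to_nat\<close> codes the cell indices of all components injectively by one
    number.\<close>
  have "(\<lambda>\<omega>. to_nat (\<lambda>i. c i \<omega>)) \<in> measurable G (count_space UNIV)"
    unfolding measurable_count_space_eq2_countable
  proof safe
    fix a
    have "(\<lambda>\<omega>. to_nat (\<lambda>i. c i \<omega>)) -` {a} \<inter> space G = {\<omega>\<in>space G. \<exists>f\<in>{f::'n\<Rightarrow>nat. to_nat f = a}. \<forall>i. c i \<omega> = f i}"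
      by (auto simp: fun_eq_iff)
    also have "\<dots> \<in> sets G"
      by (intro sets.sets_Collect_countable_Bex sets.sets_Collect_countable_All) measurable
    finally show "(\<lambda>\<omega>. to_nat (\<lambda>i. c i \<omega>)) -` {a} \<inter> space G \<in> sets G" .
  qed auto
  moreover have "dist (X \<omega>) (X \<omega>') < \<epsilon>"
    if "\<omega> \<in> space G" "\<omega>' \<in> space G" "(\<lambda>i. c i \<omega>) = (\<lambda>i. c i \<omega>')" for \<omega> \<omega>'
  proof -
    have "dist (X \<omega>) (X \<omega>') \<le> (\<Sum>i\<in>UNIV. dist (X \<omega> $ i) (X \<omega>' $ i))"
      unfolding dist_vec_def by (rule L2_set_le_sum) simp
    also have "\<dots> < (\<Sum>i\<in>(UNIV::'n set). \<delta>)"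
      using that by (intro sum_strict_mono c) (auto simp: fun_eq_iff)
    also have "\<dots> = \<epsilon>" by (simp add: \<delta>_def)
    finally show ?thesis .
  qed
  ultimately show "\<exists>c :: 'w \<Rightarrow> nat. c \<in> measurable G (count_space UNIV) \<and>
     (\<forall>\<omega>\<in>space G. \<forall>\<omega>'\<in>space G. c \<omega> = c \<omega>' \<longrightarrow> dist (X \<omega>) (X \<omega>') < \<epsilon>)"
    by (intro exI[of _ "\<lambda>\<omega>. to_nat (\<lambda>i. c i \<omega>)"]) (auto simp: inj_eq[OF inj_to_nat])
qed

text \<open>\<open>X\<close> is the pointwise limit of maps that are constant on the cells of
  partitions with vanishing oscillation. Each such map factors through a measurable
  \<open>nat\<close>-valued function and is therefore Borel, whatever the target space.\<close>

lemma discretizable_imp_borel: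
  assumes X: "discretizable G X"
  shows "X \<in> borel_measurable G"
proof -
  have "\<exists>c :: 'a \<Rightarrow> nat. c \<in> measurable G (count_space UNIV) \<and>
     (\<forall>\<omega>\<in>space G. \<forall>\<omega>'\<in>space G. c \<omega> = c \<omega>' \<longrightarrow> dist (X \<omega>) (X \<omega>') < inverse (real (Suc k)))" for k
    using X unfolding discretizable_def by (auto simp del: of_nat_Suc)
  then obtain c :: "nat \<Rightarrow> 'a \<Rightarrow> nat" where cm: "\<And>k. c k \<in> measurable G (count_space UNIV)"
    and c: "\<And>k \<omega> \<omega>'. \<omega> \<in> space G \<Longrightarrow> \<omega>' \<in> space G \<Longrightarrow> c k \<omega> = c k \<omega>' \<Longrightarrow> dist (X \<omega>) (X \<omega>') < inverse (real (Suc k))"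
    by metis
  \<comment> \<open>A representative point of cell \<open>j\<close>. Its arbitrary value on an empty
    cell is harmless, because only indices \<open>c k \<omega>\<close> of actual points
    matter.\<close>
  define r where "r k j = (SOME \<omega>'. \<omega>' \<in> space G \<and> c k \<omega>' = j)" for k j
  have r: "r k (c k \<omega>) \<in> space G" "c k (r k (c k \<omega>)) = c k \<omega>" if "\<omega> \<in> space G" for k \<omega>
    using someI[of "\<lambda>\<omega>'. \<omega>' \<in> space G \<and> c k \<omega>' = c k \<omega>" \<omega>] that by (auto simp: r_def)
  show ?thesis
  proof (rule borel_measurable_LIMSEQ_metric)
    show "(\<lambda>\<omega>. X (r k (c k \<omega>))) \<in> borel_measurable G" for k
      by (rule measurable_compose[OF cm]) simp
    show "(\<lambda>k. X (r k (c k \<omega>))) \<longlonglongrightarrow> X \<omega>" if "\<omega> \<in> space G" for \<omega>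
    proof (rule metric_tendsto_imp_tendsto[OF LIMSEQ_inverse_real_of_nat])
      show "\<forall>\<^sub>F k in sequentially. dist (X (r k (c k \<omega>))) (X \<omega>) \<le> dist (inverse (real (Suc k))) 0"
        using c[OF r(1)[OF that] that r(2)[OF that]] by (intro always_eventually) (auto intro: less_imp_le)
    qed
  qed
qed

text \<open>The simple approximants are measurable for \<open>M\<close>, but they only supply the
  countable set of their values, which comes arbitrarily close to every value of \<open>X\<close>.
  The partition is then built from \<open>X\<close> itself, so it is measurable for \<open>G\<close>
  as soon as \<open>X\<close> is.\<close>

lemma strongly_measurable_imp_discretizable:
  assumes X: "strongly_measurable M X" and XG[measurable]: "X \<in> borel_measurable G" and sp: "space G = space M"
  shows "discretizable G X"
  unfolding discretizable_def
proof (intro allI impI)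
  fix \<epsilon> :: real assume "\<epsilon> > 0"
  obtain s :: "nat \<Rightarrow> 'a \<Rightarrow> 'b" where s: "\<And>k. simple_function M (s k)"
    and lim: "\<And>\<omega>. \<omega> \<in> space M \<Longrightarrow> (\<lambda>k. s k \<omega>) \<longlonglongrightarrow> X \<omega>"
    using X unfolding strongly_measurable_def by blast
  define S where "S = (\<Union>k. s k ` space M)"
  have S: "countable S"
    unfolding S_def using simple_functionD(1)[OF s] by (simp add: countable_finite)
  define d where "d = from_nat_into S"
  have ex: "\<exists>j. dist (X \<omega>) (d j) < \<epsilon> / 2" if w: "\<omega> \<in> space G" for \<omega>
  proof -
    have "\<forall>\<^sub>F k in sequentially. dist (s k \<omega>) (X \<omega>) < \<epsilon> / 2"
      using lim w sp \<open>\<epsilon> > 0\<close> by (intro tendstoD) auto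
    then obtain k where "dist (s k \<omega>) (X \<omega>) < \<epsilon> / 2"
      by (auto simp: eventually_sequentially)
    moreover have "s k \<omega> \<in> S" using w sp by (auto simp: S_def)
    ultimately show ?thesis
      using from_nat_into_surj[OF S, of "s k \<omega>"] by (metis d_def dist_commute)
  qed
  \<comment> \<open>The cell index is the first listed point within \<open>\<epsilon> / 2\<close>;
    two values that share it are within \<open>\<epsilon>\<close> of each other.\<close>
  let ?c = "\<lambda>\<omega>. LEAST j. dist (X \<omega>) (d j) < \<epsilon> / 2"
  have "Measurable.pred G (\<lambda>\<omega>. dist (X \<omega>) (d j) < \<epsilon> / 2)" for j
  proof -
    have "(\<lambda>\<omega>. dist (X \<omega>) (d j)) \<in> borel_measurable G"
      by (rule borel_measurable_continuous_on[OF _ XG]) (intro continuous_intros)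
    then show ?thesis by measurable
  qed
  then have "?c \<in> measurable G (count_space UNIV)"
    by (rule measurable_Least)
  moreover have "dist (X \<omega>) (X \<omega>') < \<epsilon>"
    if w: "\<omega> \<in> space G" "\<omega>' \<in> space G" "?c \<omega> = ?c \<omega>'" for \<omega> \<omega>'
    using LeastI_ex[OF ex[OF w(1)]] LeastI_ex[OF ex[OF w(2)]] dist_triangle_half_l[of "X \<omega>" "d (?c \<omega>)" \<epsilon> "X \<omega>'"]
    unfolding w(3) by (simp add: dist_commute)
  ultimately show "\<exists>c :: 'a \<Rightarrow> nat. c \<in> measurable G (count_space UNIV) \<and>
     (\<forall>\<omega>\<in>space G. \<forall>\<omega>'\<in>space G. c \<omega> = c \<omega>' \<longrightarrow> dist (X \<omega>) (X \<omega>') < \<epsilon>)"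
    by blast
qed

section \<open>Expectations and independence\<close>

text \<open>Jensen's inequality for the square, in the form that the variance is
  nonnegative.\<close>

lemma (in prob_space) expectation_le_sqrt:
  fixes f :: "'a \<Rightarrow> real"
  assumes f[measurable]: "f \<in> borel_measurable M" and f2: "integrable M (\<lambda>\<omega>. (f \<omega>)\<^sup>2)"
    and b: "expectation (\<lambda>\<omega>. (f \<omega>)\<^sup>2) \<le> b\<^sup>2" "b \<ge> 0"
  shows "integrable M f" "expectation f \<le> b"
proof -
  show i: "integrable M f"
    using square_integrable_imp_integrable[OF f f2] .
  have "(expectation f)\<^sup>2 \<le> b\<^sup>2"
    using variance_positive[of f] variance_eq[OF i f2] b by linarith
  then show "expectation f \<le> b"
    using b(2) power2_le_imp_le by blast
qed

text \<open>Minkowski's inequality in L2, with numbers \<open>a\<close> and \<open>b\<close> in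
  place of the two norms. It follows by integrating Young's inequality and choosing its parameter
  well.\<close>

lemma L2_triangle_sq:
  fixes f g h :: "'a \<Rightarrow> real"
  assumes f[measurable]: "f \<in> borel_measurable M" and g[measurable]: "g \<in> borel_measurable M"
    and h[measurable]: "h \<in> borel_measurable M"
    and f2: "integrable M (\<lambda>\<omega>. (f \<omega>)\<^sup>2)" and g2: "integrable M (\<lambda>\<omega>. (g \<omega>)\<^sup>2)"
    and a: "(\<integral>\<omega>. (f \<omega>)\<^sup>2 \<partial>M) \<le> a\<^sup>2" "a \<ge> 0" and b: "(\<integral>\<omega>. (g \<omega>)\<^sup>2 \<partial>M) \<le> b\<^sup>2" "b \<ge> 0"
    and hle: "\<And>\<omega>. \<omega> \<in> space M \<Longrightarrow> \<bar>h \<omega>\<bar> \<le> f \<omega> + g \<omega>"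
  shows "integrable M (\<lambda>\<omega>. (h \<omega>)\<^sup>2)" "(\<integral>\<omega>. (h \<omega>)\<^sup>2 \<partial>M) \<le> (a + b)\<^sup>2"
proof -
  have hsq: "(h \<omega>)\<^sup>2 \<le> (f \<omega> + g \<omega>)\<^sup>2" if "\<omega> \<in> space M" for \<omega>
    using hle[OF that] by (metis abs_ge_zero order_trans power2_abs power_mono)
  have young: "(f \<omega> + g \<omega>)\<^sup>2 \<le> (1 + t) * (f \<omega>)\<^sup>2 + (1 + 1 / t) * (g \<omega>)\<^sup>2" if "t > 0" for t \<omega>
  proof -
    have "0 \<le> (t * f \<omega> - g \<omega>)\<^sup>2 / t" using that by simp
    also have "\<dots> = t * (f \<omega>)\<^sup>2 + 1 / t * (g \<omega>)\<^sup>2 - 2 * f \<omega> * g \<omega>"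
      using that by (simp add: field_simps power2_eq_square)
    finally show ?thesis by (simp add: algebra_simps power2_eq_square)
  qed
  have bnd: "(h \<omega>)\<^sup>2 \<le> (1 + t) * (f \<omega>)\<^sup>2 + (1 + 1 / t) * (g \<omega>)\<^sup>2" if "t > 0" "\<omega> \<in> space M" for t \<omega>
    using hsq[OF that(2)] young[OF that(1)] by (rule order_trans)
  show h2: "integrable M (\<lambda>\<omega>. (h \<omega>)\<^sup>2)"
  proof (rule Bochner_Integration.integrable_bound)
    show "integrable M (\<lambda>\<omega>. (1 + 1) * (f \<omega>)\<^sup>2 + (1 + 1 / 1) * (g \<omega>)\<^sup>2)"
      using f2 g2 by (intro Bochner_Integration.integrable_add integrable_mult_right)
    show "AE \<omega> in M. norm ((h \<omega>)\<^sup>2) \<le> norm ((1 + 1) * (f \<omega>)\<^sup>2 + (1 + 1 / 1) * (g \<omega>)\<^sup>2)"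
      using bnd[of 1] by (intro AE_I2) (auto intro: order_trans)
  qed simp
  have *: "(\<integral>\<omega>. (h \<omega>)\<^sup>2 \<partial>M) \<le> (1 + t) * c\<^sup>2 + (1 + 1 / t) * d\<^sup>2"
    if "t > 0" "a \<le> c" "b \<le> d" for t c d
  proof -
    have "(\<integral>\<omega>. (h \<omega>)\<^sup>2 \<partial>M) \<le> (\<integral>\<omega>. (1 + t) * (f \<omega>)\<^sup>2 + (1 + 1 / t) * (g \<omega>)\<^sup>2 \<partial>M)"
      using h2 f2 g2 bnd[OF that(1)] by (intro integral_mono) auto
    also have "\<dots> = (1 + t) * (\<integral>\<omega>. (f \<omega>)\<^sup>2 \<partial>M) + (1 + 1 / t) * (\<integral>\<omega>. (g \<omega>)\<^sup>2 \<partial>M)"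
      using f2 g2 by simp
    also have "\<dots> \<le> (1 + t) * c\<^sup>2 + (1 + 1 / t) * d\<^sup>2"
    proof (intro add_mono mult_left_mono)
      show "(\<integral>\<omega>. (f \<omega>)\<^sup>2 \<partial>M) \<le> c\<^sup>2" "(\<integral>\<omega>. (g \<omega>)\<^sup>2 \<partial>M) \<le> d\<^sup>2"
        using a b that by (meson order_trans power_mono)+
    qed (use that in auto)
    finally show ?thesis .
  qed
  \<comment> \<open>The bound \<open>*\<close> becomes the square of the sum at
    \<open>t = d / c\<close>. This ratio degenerates when a bound is \<open>0\<close>, so both are
    enlarged by \<open>\<delta>\<close>, which then tends to \<open>0\<close>.\<close>
  have **: "(\<integral>\<omega>. (h \<omega>)\<^sup>2 \<partial>M) \<le> (a + b + 2 * \<delta>)\<^sup>2" if "\<delta> > 0" for \<delta>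
  proof -
    let ?c = "a + \<delta>" and ?d = "b + \<delta>"
    have p: "?c > 0" "?d > 0" using a b that by auto
    have "(\<integral>\<omega>. (h \<omega>)\<^sup>2 \<partial>M) \<le> (1 + ?d / ?c) * ?c\<^sup>2 + (1 + 1 / (?d / ?c)) * ?d\<^sup>2"
      using p that by (intro *) auto
    also have "\<dots> = (?c + ?d)\<^sup>2"
    proof -
      have "(1 + d / c) * c\<^sup>2 + (1 + 1 / (d / c)) * d\<^sup>2 = (c + d)\<^sup>2" if "c > 0" "d > 0" for c d :: real
        using that by (simp add: field_simps power2_eq_square)
      from this[OF p] show ?thesis .
    qed
    finally show ?thesis by (simp add: algebra_simps)
  qed
  have "((\<lambda>\<delta>. (a + b + 2 * \<delta>)\<^sup>2) \<longlongrightarrow> (a + b + 2 * 0)\<^sup>2) (at_right (0::real))"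
    by (intro tendsto_intros)
  then show "(\<integral>\<omega>. (h \<omega>)\<^sup>2 \<partial>M) \<le> (a + b)\<^sup>2"
    using ** by (intro tendsto_lowerbound[of _ "(a + b)\<^sup>2" "at_right 0"])
      (auto simp: eventually_at_right_field intro!: exI[of _ "1::real"])
qed

text \<open>Independence of \<open>A\<close> from the events of \<open>G\<close> makes
  \<open>indicator A\<close> and \<open>g\<close> independent random variables, and the expectation
  of their product factors.\<close>

lemma (in prob_space) expectation_indicator_mult:
  fixes g :: "'a \<Rightarrow> real"
  assumes A: "A \<in> events" and sub: "subalgebra M G"
    and indep: "\<And>B. B \<in> sets G \<Longrightarrow> prob (A \<inter> B) = prob A * prob B"
    and g: "g \<in> borel_measurable G" and gi: "integrable M g"
  shows "integrable M (\<lambda>\<omega>. indicator A \<omega> * g \<omega>)"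
    "expectation (\<lambda>\<omega>. indicator A \<omega> * g \<omega>) = prob A * expectation g"
proof -
  have sp: "space G = space M" and G: "sets G \<subseteq> events"
    using sub by (auto simp: subalgebra_def)
  have "indep_set (sigma_sets (space M) {A}) (sigma_sets (space M) (sets G))"
    using A G indep sets.Int_stable[of G]
    by (intro indep_set_sigma_sets indep_setI) (auto simp: Int_stable_def)
  moreover have "sigma_sets (space M) (sets G) = sets G"
    using sets.sigma_sets_eq[of G] sp by simp
  ultimately have ind: "indep_set (sigma_sets (space M) {A}) (sets G)" by simp
  have iv: "indep_var borel (indicator A :: 'a \<Rightarrow> real) borel g"
    unfolding indep_var_eq
  proof (intro conjI)
    show "random_variable borel (indicator A :: 'a \<Rightarrow> real)" using A by simp
    show "random_variable borel g" using gi by simp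
    \<comment> \<open>An indicator has only four possible preimages, all of which lie in the
      sigma-algebra generated by \<open>A\<close>.\<close>
    have "sigma_sets (space M) {(indicator A :: 'a \<Rightarrow> real) -` S \<inter> space M |S. S \<in> sets borel} \<subseteq> sigma_sets (space M) {A}"
    proof (rule sigma_sets_mono, safe)
      fix S :: "real set"
      have "A \<subseteq> space M" using A by (rule sets.sets_into_space)
      moreover have "(indicator A :: 'a \<Rightarrow> real) -` S = (if 1 \<in> S then A else {}) \<union> (if 0 \<in> S then - A else {})"
      proof (rule set_eqI)
        fix \<omega>
        show "\<omega> \<in> (indicator A :: 'a \<Rightarrow> real) -` S \<longleftrightarrow> \<omega> \<in> (if 1 \<in> S then A else {}) \<union> (if 0 \<in> S then - A else {})"
          by (cases "\<omega> \<in> A") auto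
      qed
      ultimately have X: "(indicator A :: 'a \<Rightarrow> real) -` S \<inter> space M \<in> {{}, A, space M - A, space M}"
        by (cases "(0::real) \<in> S"; cases "(1::real) \<in> S") auto
      have "A \<in> sigma_sets (space M) {A}" by (rule sigma_sets.Basic) simp
      then have "{{}, A, space M - A, space M} \<subseteq> sigma_sets (space M) {A}"
        using sigma_sets.Empty[of "space M" "{A}"] sigma_sets.Compl[of A "space M" "{A}"] sigma_sets_top[of "space M" "{A}"]
        by (intro insert_subsetI empty_subsetI)
      then show "(indicator A :: 'a \<Rightarrow> real) -` S \<inter> space M \<in> sigma_sets (space M) {A}"
        using X by (rule subsetD)
    qed
    moreover have "sigma_sets (space M) {g -` S \<inter> space M |S. S \<in> sets borel} \<subseteq> sets G"
    proof -
      have "{g -` S \<inter> space M |S. S \<in> sets borel} \<subseteq> sets G"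
        using measurable_sets[OF g] sp by auto
      from sets.sigma_sets_subset[OF this] show ?thesis using sp by simp
    qed
    ultimately show "indep_set (sigma_sets (space M) {(indicator A :: 'a \<Rightarrow> real) -` S \<inter> space M |S. S \<in> sets borel})
       (sigma_sets (space M) {g -` S \<inter> space M |S. S \<in> sets borel})"
      using ind unfolding indep_sets2_eq by blast
  qed
  show "integrable M (\<lambda>\<omega>. indicator A \<omega> * g \<omega>)"
    "expectation (\<lambda>\<omega>. indicator A \<omega> * g \<omega>) = prob A * expectation g"
    using indep_var_integrable[OF iv _ gi] indep_var_lebesgue_integral[OF iv _ gi] A
    by (auto simp: integrable_indicator_iff emeasure_eq_measure)
qed

section \<open>Sigma-algebras generated by processes, and independence from the history\<close>

lemma space_process_sigma [simp]: "space (process_sigma M N X) = space M"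
  by (simp add: process_sigma_def)

lemma measurable_process_sigma:
  assumes "\<And>l. X l \<in> measurable M N"
  shows "X l \<in> measurable (process_sigma M N X) N"
proof -
  have "(\<lambda>\<omega> l. X l \<omega>) \<in> measurable (process_sigma M N X) (Pi\<^sub>M UNIV (\<lambda>_. N))"
    unfolding process_sigma_def using assms
    by (intro measurable_vimage_algebra1) (auto simp: space_PiM dest: measurable_space)
  from measurable_compose[OF this measurable_component_singleton[of l]] show ?thesis by simp
qed

lemma indicator_component_in_process:
  fixes u :: "nat \<Rightarrow> 'w \<Rightarrow> real ^ 'n::finite"
  assumes "\<And>l. u l \<in> borel_measurable M"
  shows "{\<omega> \<in> space M. u l \<omega> $ i = 1} \<in> sets (process_sigma M borel u)"
proof -
  have [measurable]: "u l \<in> borel_measurable (process_sigma M borel u)"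
    by (rule measurable_process_sigma) (rule assms)
  have "{\<omega> \<in> space (process_sigma M borel u). u l \<omega> $ i = 1} \<in> sets (process_sigma M borel u)"
    by measurable
  then show ?thesis by simp
qed

text \<open>The sigma-algebra generated by \<open>X 0, ..., X (l - 1)\<close>. Time \<open>l\<close>
  is excluded so that \<open>X l\<close> can be independent of it.\<close>

definition past :: "'w measure \<Rightarrow> 'b measure \<Rightarrow> (nat \<Rightarrow> 'w \<Rightarrow> 'b) \<Rightarrow> nat \<Rightarrow> 'w measure" where
  "past M N X l = vimage_algebra (space M) (\<lambda>\<omega>. \<lambda>k\<in>{..<l}. X k \<omega>) (Pi\<^sub>M {..<l} (\<lambda>_. N))"

text \<open>The join of the past of \<open>X\<close> with the whole of \<open>Y\<close>.
  Intersections serve as generator because they form a pi-system on which probabilities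
  factor.\<close>

definition history ::
  "'w measure \<Rightarrow> 'b measure \<Rightarrow> (nat \<Rightarrow> 'w \<Rightarrow> 'b) \<Rightarrow> 'c measure \<Rightarrow> (nat \<Rightarrow> 'w \<Rightarrow> 'c) \<Rightarrow> nat \<Rightarrow> 'w measure"
where
  "history M N X L Y l = sigma (space M)
     {B \<inter> C | B C. B \<in> sets (past M N X l) \<and> C \<in> sets (process_sigma M L Y)}"

lemma space_past [simp]: "space (past M N X l) = space M"
  by (simp add: past_def)

lemma measurable_past:
  assumes "\<And>l. X l \<in> measurable M N" "k < l"
  shows "X k \<in> measurable (past M N X l) N"
proof -
  have "(\<lambda>\<omega>. \<lambda>k\<in>{..<l}. X k \<omega>) \<in> measurable (past M N X l) (Pi\<^sub>M {..<l} (\<lambda>_. N))"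
    unfolding past_def using measurable_space[OF assms(1)]
    by (intro measurable_vimage_algebra1) (auto simp: space_PiM PiE_iff)
  from measurable_compose[OF this measurable_component_singleton[of k]] assms(2) show ?thesis by simp
qed

lemma past_le_process_sigma:
  assumes "\<And>l. X l \<in> measurable M N"
  shows "sets (past M N X l) \<subseteq> sets (process_sigma M N X)"
proof -
  have "(\<lambda>\<omega>. \<lambda>k\<in>{..<l}. X k \<omega>) \<in> measurable (process_sigma M N X) (Pi\<^sub>M {..<l} (\<lambda>_. N))"
    by (intro measurable_restrict measurable_process_sigma assms)
  note m = this
  then have "(\<lambda>\<omega>. \<lambda>k\<in>{..<l}. X k \<omega>) \<in> space M \<rightarrow> space (Pi\<^sub>M {..<l} (\<lambda>_. N))"
    using measurable_space[OF m] by simp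
  then show ?thesis
    using measurable_sets[OF m] unfolding past_def by (subst sets_vimage_algebra2) auto
qed

lemma history_generator_subset:
  "{B \<inter> C | B C. B \<in> sets (past M N X l) \<and> C \<in> sets (process_sigma M L Y)} \<subseteq> Pow (space M)"
  using sets.sets_into_space[of _ "past M N X l"] by fastforce

lemma space_history [simp]: "space (history M N X L Y l) = space M"
  unfolding history_def by (rule space_measure_of[OF history_generator_subset])

lemma past_le_history: "sets (past M N X l) \<subseteq> sets (history M N X L Y l)"
proof
  fix B assume B: "B \<in> sets (past M N X l)"
  have "B \<inter> space M = B" using sets.sets_into_space[OF B] by auto
  moreover have "space M \<in> sets (process_sigma M L Y)"
    using sets.top[of "process_sigma M L Y"] by simp
  ultimately show "B \<in> sets (history M N X L Y l)"
    unfolding history_def sets_measure_of[OF history_generator_subset] using B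
    by (intro sigma_sets.Basic) blast
qed

lemma process_sigma_le_history: "sets (process_sigma M L Y) \<subseteq> sets (history M N X L Y l)"
proof
  fix C assume C: "C \<in> sets (process_sigma M L Y)"
  have "space M \<inter> C = C" using sets.sets_into_space[OF C] by auto
  moreover have "space M \<in> sets (past M N X l)"
    using sets.top[of "past M N X l"] by simp
  ultimately show "C \<in> sets (history M N X L Y l)"
    unfolding history_def sets_measure_of[OF history_generator_subset] using C
    by (intro sigma_sets.Basic) blast
qed

text \<open>For \<open>A\<close> at time \<open>l\<close>, \<open>B\<close> in the past of
  \<open>X\<close> and \<open>C\<close> from \<open>Y\<close>, P(ABC) = P(AB) P(C) = P(A) P(B) P(C)
  = P(A) P(BC). The outer equalities use independence of the two processes, the middle one
  independence within \<open>X\<close>. The pi-system of all \<open>B \<inter> C\<close> carries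
  this to the whole history.\<close>

lemma (in prob_space) indep_history:
  assumes X: "\<And>l. X l \<in> measurable M N" and iX: "indep_vars (\<lambda>_. N) X UNIV"
    and XY: "indep_processes M N X L Y" and S: "S \<in> sets N"
  shows "subalgebra M (history M N X L Y l)"
    "\<And>B. B \<in> sets (history M N X L Y l) \<Longrightarrow> prob ((X l -` S \<inter> space M) \<inter> B) = prob (X l -` S \<inter> space M) * prob B"
proof -
  let ?A = "X l -` S \<inter> space M"
  let ?E = "{B \<inter> C | B C. B \<in> sets (past M N X l) \<and> C \<in> sets (process_sigma M L Y)}"
  have ind: "indep_set (sets (process_sigma M N X)) (sets (process_sigma M L Y))"
    using XY unfolding indep_processes_def .
  have AP: "?A \<in> sets (process_sigma M N X)"
    using measurable_sets[OF measurable_process_sigma[of X, OF X] S] by simp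
  have BP: "B \<in> sets (process_sigma M N X)" if "B \<in> sets (past M N X l)" for B
    using past_le_process_sigma[of X, OF X] that by blast
  have AB: "prob (?A \<inter> B) = prob ?A * prob B" if B: "B \<in> sets (past M N X l)" for B
  proof -
    have "indep_var (Pi\<^sub>M {l} (\<lambda>_. N)) (\<lambda>\<omega>. restrict (\<lambda>i. X i \<omega>) {l})
       (Pi\<^sub>M {..<l} (\<lambda>_. N)) (\<lambda>\<omega>. restrict (\<lambda>i. X i \<omega>) {..<l})"
      by (rule indep_var_restrict[OF iX]) auto
    then have i: "indep_set
       (sigma_sets (space M) {(\<lambda>\<omega>. restrict (\<lambda>i. X i \<omega>) {l}) -` A \<inter> space M |A. A \<in> sets (Pi\<^sub>M {l} (\<lambda>_. N))})
       (sets (past M N X l))"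
      unfolding indep_var_eq past_def sets_vimage_algebra by auto
    have "(\<lambda>f. f l) \<in> measurable (Pi\<^sub>M {l} (\<lambda>_. N)) N" by simp
    from measurable_sets[OF this S] have "(\<lambda>f. f l) -` S \<inter> space (Pi\<^sub>M {l} (\<lambda>_. N)) \<in> sets (Pi\<^sub>M {l} (\<lambda>_. N))" .
    \<comment> \<open>The event is rewritten through the family restricted to \<open>{l}\<close>,
      since independence of disjoint index blocks is phrased for restricted families.\<close>
    moreover have "?A = (\<lambda>\<omega>. restrict (\<lambda>i. X i \<omega>) {l}) -` ((\<lambda>f. f l) -` S \<inter> space (Pi\<^sub>M {l} (\<lambda>_. N))) \<inter> space M"
      using measurable_space[OF X] by (auto simp: space_PiM)
    ultimately have "?A \<in> sigma_sets (space M) {(\<lambda>\<omega>. restrict (\<lambda>i. X i \<omega>) {l}) -` A \<inter> space M |A. A \<in> sets (Pi\<^sub>M {l} (\<lambda>_. N))}"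
      by (intro sigma_sets.Basic) blast
    from indep_setD[OF i this B] show ?thesis .
  qed
  have Pev: "sets (process_sigma M N X) \<subseteq> events" "sets (process_sigma M L Y) \<subseteq> events"
    using indep_setD_ev1[OF ind] indep_setD_ev2[OF ind] by auto
  have Eev: "?E \<subseteq> events" using BP Pev by blast
  have hist: "sets (history M N X L Y l) = sigma_sets (space M) ?E"
    unfolding history_def by (rule sets_measure_of[OF history_generator_subset])
  have "prob (?A \<inter> (B \<inter> C)) = prob ?A * prob (B \<inter> C)"
    if B: "B \<in> sets (past M N X l)" and C: "C \<in> sets (process_sigma M L Y)" for B C
    using indep_setD[OF ind _ C, of "?A \<inter> B"] indep_setD[OF ind BP[OF B] C] AB[OF B] AP BP[OF B]
    by (simp add: Int_assoc[symmetric])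
  then have "indep_set {?A} ?E"
    using AP Pev Eev by (intro indep_setI) auto
  moreover have "Int_stable ?E"
  proof (rule Int_stableI)
    fix a b assume "a \<in> ?E" "b \<in> ?E"
    then obtain B C B' C' where "a = B \<inter> C" "b = B' \<inter> C'" "B \<in> sets (past M N X l)" "B' \<in> sets (past M N X l)"
      "C \<in> sets (process_sigma M L Y)" "C' \<in> sets (process_sigma M L Y)" by blast
    then show "a \<inter> b \<in> ?E"
      by (intro CollectI exI[of _ "B \<inter> B'"] exI[of _ "C \<inter> C'"]) auto
  qed
  ultimately have "indep_set (sigma_sets (space M) {?A}) (sets (history M N X L Y l))"
    unfolding hist by (intro indep_set_sigma_sets) (auto simp: Int_stable_def)
  note ind' = this
  show "subalgebra M (history M N X L Y l)"
    using indep_setD_ev2[OF ind'] by (simp add: subalgebra_def)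
  show "prob (?A \<inter> B) = prob ?A * prob B" if "B \<in> sets (history M N X L Y l)" for B
    by (rule indep_setD[OF ind' _ that]) (rule sigma_sets.Basic, simp)
qed

section \<open>The weighted norm\<close>

text \<open>
  The weights \<open>1 / p i\<close> cancel the update probabilities in expectation.
\<close>

definition wnorm :: "('n::finite \<Rightarrow> real) \<Rightarrow> 'a::real_normed_vector ^ 'n \<Rightarrow> real" where
  "wnorm p y = norm (\<chi> i. (1 / sqrt (p i)) *\<^sub>R (y $ i))"

lemma norm_sq_vec: "(norm y)\<^sup>2 = (\<Sum>i\<in>UNIV. (norm (y $ i))\<^sup>2)"
  for y :: "'a::real_normed_vector ^ 'n::finite"
  by (simp add: norm_vec_def L2_set_def sum_nonneg)

lemma wnorm_sq:
  fixes y :: "'a::real_normed_vector ^ 'n::finite"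
  assumes "\<And>i. p i > 0"
  shows "(wnorm p y)\<^sup>2 = (\<Sum>i\<in>UNIV. (norm (y $ i))\<^sup>2 / p i)"
proof -
  have "(norm ((1 / sqrt (p i)) *\<^sub>R (y $ i)))\<^sup>2 = (norm (y $ i))\<^sup>2 / p i" for i
    using assms[of i] by (simp add: power_divide)
  then show ?thesis
    by (simp add: wnorm_def norm_sq_vec)
qed

lemma wnorm_nonneg [simp]: "wnorm p y \<ge> 0"
  by (simp add: wnorm_def)

lemma wnorm_triangle: "wnorm p (y + z) \<le> wnorm p y + wnorm p z"
proof -
  have "(\<chi> i. (1 / sqrt (p i)) *\<^sub>R ((y + z) $ i)) =
      (\<chi> i. (1 / sqrt (p i)) *\<^sub>R (y $ i)) + (\<chi> i. (1 / sqrt (p i)) *\<^sub>R (z $ i))"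
    by (simp add: vec_eq_iff scaleR_add_right)
  then show ?thesis
    unfolding wnorm_def using norm_triangle_ineq by (rule ord_eq_le_trans[OF arg_cong])
qed

text \<open>Every weight is at most \<open>1 / m\<close>. Taken with the least probability here and
  the greatest one in \<open>norm_le_wnorm\<close>, the two comparisons produce the factor
  \<open>sqrt (pmax / pmin)\<close>.\<close>

lemma wnorm_le:
  assumes "\<And>i. p i > 0" and m: "m > 0" "\<And>i. m \<le> p i"
  shows "wnorm p y \<le> norm y / sqrt m"
proof (rule power2_le_imp_le)
  have "(wnorm p y)\<^sup>2 \<le> (\<Sum>i\<in>UNIV. (norm (y $ i))\<^sup>2 / m)"
    unfolding wnorm_sq[where p = p, OF assms(1)] using assms by (intro sum_mono divide_left_mono) auto
  also have "\<dots> = (norm y / sqrt m)\<^sup>2"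
    using m by (simp add: norm_sq_vec[of y] power_divide sum_divide_distrib)
  finally show "(wnorm p y)\<^sup>2 \<le> (norm y / sqrt m)\<^sup>2" .
qed (use m in simp)

lemma norm_le_wnorm:
  assumes "\<And>i. p i > 0" and m: "\<And>i. p i \<le> m"
  shows "norm y \<le> sqrt m * wnorm p y"
proof (rule power2_le_imp_le)
  have m0: "m > 0" using assms(1) m by (meson less_le_trans)
  have "(norm (y $ i))\<^sup>2 \<le> m * ((norm (y $ i))\<^sup>2 / p i)" for i
  proof -
    have "p i * ((norm (y $ i))\<^sup>2 / p i) \<le> m * ((norm (y $ i))\<^sup>2 / p i)"
      using assms(1)[of i] m[of i] by (intro mult_right_mono) auto
    then show ?thesis using assms(1)[of i] by simp
  qed
  then have "(norm y)\<^sup>2 \<le> (\<Sum>i\<in>UNIV. m * ((norm (y $ i))\<^sup>2 / p i))"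
    unfolding norm_sq_vec[of y] by (intro sum_mono) 
  also have "\<dots> = (sqrt m * wnorm p y)\<^sup>2"
    using m0 by (simp add: power_mult_distrib wnorm_sq[where p = p, OF assms(1)] sum_distrib_left)
  finally show "(norm y)\<^sup>2 \<le> (sqrt m * wnorm p y)\<^sup>2" .
  show "0 \<le> sqrt m * wnorm p y" using m0 by simp
qed

lemma continuous_wnorm:
  fixes p :: "'n::finite \<Rightarrow> real"
  shows "continuous_on UNIV (wnorm p :: 'a::real_normed_vector ^ 'n \<Rightarrow> real)"
  unfolding wnorm_def by (intro continuous_intros)

text \<open>The squared weighted norm separates the coordinates, so only the marginal probabilities
  of the \<open>A i\<close> enter. With D and T the second moments of coordinate \<open>i\<close> of
  \<open>d\<close> and \<open>t\<close>, that coordinate contributes ((1 - p) D + p T) / p = D / p -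
  D + T, where p is \<open>p i\<close>.\<close>

lemma (in prob_space) expectation_wnorm_update:
  fixes d t z :: "'a \<Rightarrow> 'b::real_normed_vector ^ 'n::finite" and p :: "'n \<Rightarrow> real"
  assumes p: "\<And>i. p i > 0" and A: "\<And>i. A i \<in> events" "\<And>i. prob (A i) = p i"
    and sub: "subalgebra M G"
    and indep: "\<And>i B. B \<in> sets G \<Longrightarrow> prob (A i \<inter> B) = prob (A i) * prob B"
    and d: "d \<in> borel_measurable G" and t: "t \<in> borel_measurable G"
    and di: "integrable M (\<lambda>\<omega>. (norm (d \<omega>))\<^sup>2)" and ti: "integrable M (\<lambda>\<omega>. (norm (t \<omega>))\<^sup>2)"
    and z: "\<And>\<omega> i. \<omega> \<in> space M \<Longrightarrow> z \<omega> $ i = (if \<omega> \<in> A i then t \<omega> $ i else d \<omega> $ i)"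
  shows "integrable M (\<lambda>\<omega>. (wnorm p (z \<omega>))\<^sup>2)"
    "expectation (\<lambda>\<omega>. (wnorm p (z \<omega>))\<^sup>2) =
      expectation (\<lambda>\<omega>. (wnorm p (d \<omega>))\<^sup>2) - expectation (\<lambda>\<omega>. (norm (d \<omega>))\<^sup>2) + expectation (\<lambda>\<omega>. (norm (t \<omega>))\<^sup>2)"
proof -
  have comp: "(\<lambda>\<omega>. (norm (f \<omega> $ i))\<^sup>2) \<in> borel_measurable G"
    if "f \<in> borel_measurable G" for f :: "'a \<Rightarrow> 'b ^ 'n" and i
  proof -
    have "continuous_on UNIV (\<lambda>v :: 'b ^ 'n. (norm (v $ i))\<^sup>2)" by (intro continuous_intros)
    from borel_measurable_continuous_on[OF this that] show ?thesis .
  qed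
  have compi: "integrable M (\<lambda>\<omega>. (norm (f \<omega> $ i))\<^sup>2)"
    if "f \<in> borel_measurable G" "integrable M (\<lambda>\<omega>. (norm (f \<omega>))\<^sup>2)" for f :: "'a \<Rightarrow> 'b ^ 'n" and i
    using measurable_from_subalg[OF sub comp[OF that(1)]]
    by (intro Bochner_Integration.integrable_bound[OF that(2)]) (simp_all add: power_mono Finite_Cartesian_Product.norm_nth_le)
  note D = compi[OF d di] and T = compi[OF t ti]
  have ID: "integrable M (\<lambda>\<omega>. indicator (A i) \<omega> * (norm (d \<omega> $ i))\<^sup>2)"
    "expectation (\<lambda>\<omega>. indicator (A i) \<omega> * (norm (d \<omega> $ i))\<^sup>2) = p i * expectation (\<lambda>\<omega>. (norm (d \<omega> $ i))\<^sup>2)" for i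
    using expectation_indicator_mult[OF A(1)[of i] sub indep comp[OF d, of i] D[of i]] A(2)[of i] by simp_all
  have IT: "integrable M (\<lambda>\<omega>. indicator (A i) \<omega> * (norm (t \<omega> $ i))\<^sup>2)"
    "expectation (\<lambda>\<omega>. indicator (A i) \<omega> * (norm (t \<omega> $ i))\<^sup>2) = p i * expectation (\<lambda>\<omega>. (norm (t \<omega> $ i))\<^sup>2)" for i
    using expectation_indicator_mult[OF A(1)[of i] sub indep comp[OF t, of i] T[of i]] A(2)[of i] by simp_all
  \<comment> \<open>The case distinction in \<open>z\<close> is written with indicators, so that
    \<open>ID\<close> and \<open>IT\<close> evaluate each summand.\<close>
  let ?f = "\<lambda>i \<omega>. ((norm (d \<omega> $ i))\<^sup>2 - indicator (A i) \<omega> * (norm (d \<omega> $ i))\<^sup>2 + indicator (A i) \<omega> * (norm (t \<omega> $ i))\<^sup>2) / p i"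
  have eq: "(wnorm p (z \<omega>))\<^sup>2 = (\<Sum>i\<in>UNIV. ?f i \<omega>)" if "\<omega> \<in> space M" for \<omega>
    unfolding wnorm_sq[where p = p, OF p] using z[OF that] by (intro sum.cong refl) (simp add: indicator_def)
  have fi: "integrable M (?f i)" for i
    using D[of i] ID(1)[of i] IT(1)[of i] by simp
  have fe: "expectation (?f i) = expectation (\<lambda>\<omega>. (norm (d \<omega> $ i))\<^sup>2) / p i - expectation (\<lambda>\<omega>. (norm (d \<omega> $ i))\<^sup>2)
      + expectation (\<lambda>\<omega>. (norm (t \<omega> $ i))\<^sup>2)" for i
  proof -
    have "expectation (?f i) = (expectation (\<lambda>\<omega>. (norm (d \<omega> $ i))\<^sup>2) - p i * expectation (\<lambda>\<omega>. (norm (d \<omega> $ i))\<^sup>2)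
      + p i * expectation (\<lambda>\<omega>. (norm (t \<omega> $ i))\<^sup>2)) / p i"
      using D[of i] ID[of i] IT[of i] by simp
    then show ?thesis using p[of i] by (simp add: field_simps)
  qed
  show "integrable M (\<lambda>\<omega>. (wnorm p (z \<omega>))\<^sup>2)"
    using fi by (subst Bochner_Integration.integrable_cong[OF refl eq]) auto
  have "expectation (\<lambda>\<omega>. (wnorm p (z \<omega>))\<^sup>2) = (\<Sum>i\<in>UNIV. expectation (?f i))"
    using fi by (subst Bochner_Integration.integral_cong[OF refl eq]) auto
  also have "\<dots> = expectation (\<lambda>\<omega>. (wnorm p (d \<omega>))\<^sup>2) - expectation (\<lambda>\<omega>. (norm (d \<omega>))\<^sup>2) + expectation (\<lambda>\<omega>. (norm (t \<omega>))\<^sup>2)"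
    unfolding fe wnorm_sq[where p = p, OF p] norm_sq_vec using D T by (simp add: sum.distrib sum_subtractf)
  finally show "expectation (\<lambda>\<omega>. (wnorm p (z \<omega>))\<^sup>2) =
      expectation (\<lambda>\<omega>. (wnorm p (d \<omega>))\<^sup>2) - expectation (\<lambda>\<omega>. (norm (d \<omega>))\<^sup>2) + expectation (\<lambda>\<omega>. (norm (t \<omega>))\<^sup>2)" .
qed

text \<open>By the update identity, the contraction removes at least
  \<open>1 - \<zeta>\<^sup>2\<close> times the second moment of \<open>norm d\<close>, which is at
  least \<open>m\<close> times that of the weighted norm.\<close>

lemma (in prob_space) expectation_wnorm_contraction:
  fixes d t z :: "'a \<Rightarrow> 'b::real_normed_vector ^ 'n::finite" and p :: "'n \<Rightarrow> real"
  assumes p: "\<And>i. p i > 0" and A: "\<And>i. A i \<in> events" "\<And>i. prob (A i) = p i"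
    and sub: "subalgebra M G"
    and indep: "\<And>i B. B \<in> sets G \<Longrightarrow> prob (A i \<inter> B) = prob (A i) * prob B"
    and d: "d \<in> borel_measurable G" and t: "t \<in> borel_measurable G"
    and di: "integrable M (\<lambda>\<omega>. (wnorm p (d \<omega>))\<^sup>2)"
    and z: "\<And>\<omega> i. \<omega> \<in> space M \<Longrightarrow> z \<omega> $ i = (if \<omega> \<in> A i then t \<omega> $ i else d \<omega> $ i)"
    and td: "\<And>\<omega>. \<omega> \<in> space M \<Longrightarrow> norm (t \<omega>) \<le> \<zeta> * norm (d \<omega>)" and \<zeta>: "0 < \<zeta>" "\<zeta> < 1"
    and m: "m > 0" "\<And>i. m \<le> p i"
  shows "integrable M (\<lambda>\<omega>. (wnorm p (z \<omega>))\<^sup>2)"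
    "expectation (\<lambda>\<omega>. (wnorm p (z \<omega>))\<^sup>2) \<le> (1 - m + m * \<zeta>\<^sup>2) * expectation (\<lambda>\<omega>. (wnorm p (d \<omega>))\<^sup>2)"
proof -
  note [measurable] = measurable_from_subalg[OF sub d] measurable_from_subalg[OF sub t]
  have p1: "p i \<le> 1" for i using prob_le_1[of "A i"] A(2)[of i] by simp
    \<comment> \<open>Probabilities are at most \<open>1\<close>, so the weighted norm dominates the
      original one and passes its integrability on to it.\<close>
    have nd: "(norm (d \<omega>))\<^sup>2 \<le> (wnorm p (d \<omega>))\<^sup>2" for \<omega>
    using norm_le_wnorm[where p = p and y = "d \<omega>", OF p p1] by (intro power_mono) auto
    have di': "integrable M (\<lambda>\<omega>. (norm (d \<omega>))\<^sup>2)"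
    by (rule Bochner_Integration.integrable_bound[OF di]) (use nd in auto)
  have nt: "(norm (t \<omega>))\<^sup>2 \<le> \<zeta>\<^sup>2 * (norm (d \<omega>))\<^sup>2" if "\<omega> \<in> space M" for \<omega>
    using td[OF that] by (metis norm_ge_zero power_mono power_mult_distrib)
  have ti: "integrable M (\<lambda>\<omega>. (norm (t \<omega>))\<^sup>2)"
    by (rule Bochner_Integration.integrable_bound[OF integrable_mult_right[OF di', of "\<zeta>\<^sup>2"]]) (use nt in auto)
  note U = expectation_wnorm_update[OF p A sub indep d t di' ti z]
  show "integrable M (\<lambda>\<omega>. (wnorm p (z \<omega>))\<^sup>2)" using U(1) by blast
  have mn: "m * expectation (\<lambda>\<omega>. (wnorm p (d \<omega>))\<^sup>2) \<le> expectation (\<lambda>\<omega>. (norm (d \<omega>))\<^sup>2)"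
  proof -
    have "m * (wnorm p (d \<omega>))\<^sup>2 \<le> (norm (d \<omega>))\<^sup>2" for \<omega>
    proof -
      have "(wnorm p (d \<omega>))\<^sup>2 \<le> (norm (d \<omega>) / sqrt m)\<^sup>2"
        using wnorm_le[where p = p and y = "d \<omega>", OF p m] by (intro power_mono) auto
      then show ?thesis using m by (simp add: power_divide field_simps)
    qed
    then have "expectation (\<lambda>\<omega>. m * (wnorm p (d \<omega>))\<^sup>2) \<le> expectation (\<lambda>\<omega>. (norm (d \<omega>))\<^sup>2)"
      using di di' by (intro integral_mono) auto
    then show ?thesis by simp
  qed
  have "expectation (\<lambda>\<omega>. (norm (t \<omega>))\<^sup>2) \<le> expectation (\<lambda>\<omega>. \<zeta>\<^sup>2 * (norm (d \<omega>))\<^sup>2)"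
    using ti di' nt by (intro integral_mono) auto
  then have "expectation (\<lambda>\<omega>. (wnorm p (z \<omega>))\<^sup>2) \<le> expectation (\<lambda>\<omega>. (wnorm p (d \<omega>))\<^sup>2)
      - (1 - \<zeta>\<^sup>2) * expectation (\<lambda>\<omega>. (norm (d \<omega>))\<^sup>2)"
    using U(2) by (simp add: algebra_simps)
  also have "\<dots> \<le> expectation (\<lambda>\<omega>. (wnorm p (d \<omega>))\<^sup>2) - (1 - \<zeta>\<^sup>2) * (m * expectation (\<lambda>\<omega>. (wnorm p (d \<omega>))\<^sup>2))"
    using mn \<zeta> by (intro diff_left_mono mult_left_mono) (auto simp: power_le_one)
  finally show "expectation (\<lambda>\<omega>. (wnorm p (z \<omega>))\<^sup>2) \<le> (1 - m + m * \<zeta>\<^sup>2) * expectation (\<lambda>\<omega>. (wnorm p (d \<omega>))\<^sup>2)"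
    by (simp add: algebra_simps)
qed

section \<open>The error recursion\<close>

lemma affine_recurrence_closed_form:
  fixes c :: real
  assumes c: "c \<noteq> 1" and "a 0 = a0" "\<And>l. a (Suc l) = c * a l + b"
  shows "a l = c ^ l * a0 + (1 - c ^ l) / (1 - c) * b"
proof (induction l)
  case (Suc l)
  have "a (Suc l) = c * (c ^ l * a0 + (1 - c ^ l) / (1 - c) * b) + b"
    using assms Suc by simp
  also have "\<dots> = c ^ Suc l * a0 + (1 - c ^ Suc l) / (1 - c) * b"
    using c by (simp add: field_simps)
  finally show ?case .
qed (use assms in simp)

text \<open>The masked vectors enter Minkowski's inequality only through their weighted norms;
  measurability of these is recovered as the square root of an integrable function.\<close>

lemma wnorm_sq_integrable_imp_measurable:
  assumes "integrable M (\<lambda>\<omega>. (wnorm p (z \<omega>))\<^sup>2)"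
  shows "(\<lambda>\<omega>. wnorm p (z \<omega>)) \<in> borel_measurable M"
proof -
  have "(\<lambda>\<omega>. sqrt ((wnorm p (z \<omega>))\<^sup>2)) \<in> borel_measurable M"
    by (rule measurable_compose[OF borel_measurable_integrable[OF assms] borel_measurable_sqrt])
  then show ?thesis by simp
qed

theorem proposition1:
  fixes M :: "'w measure"
    and H :: "'n::finite \<Rightarrow> 'a::real_inner set"
    and T :: "nat \<Rightarrow> 'a ^ 'n \<Rightarrow> 'a ^ 'n"
    and xbar :: "nat \<Rightarrow> 'a ^ 'n"
    and u :: "nat \<Rightarrow> 'w \<Rightarrow> real ^ 'n"
    and e :: "nat \<Rightarrow> 'w \<Rightarrow> 'a ^ 'n"
    and x :: "nat \<Rightarrow> 'w \<Rightarrow> 'a ^ 'n"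
    and x0 :: "'a ^ 'n"
    and p :: "'n \<Rightarrow> real"
    and \<zeta> \<sigma> \<nu> :: real
  assumes prob: "prob_space M"
    and hilbert: "\<And>i. hilbert_subspace (H i)"
    and contr: "\<And>l. contractive \<zeta> (direct_sum H) (T l)"
    and xbar_in: "\<And>l. xbar l \<in> direct_sum H"
    and xbar_fix: "\<And>l. xbar l = T l (xbar l)"
    and sigma: "\<sigma> \<ge> 0"
    and drift: "\<And>l. l \<ge> 1 \<Longrightarrow> norm (xbar l - xbar (l - 1)) \<le> \<sigma>"
    and u_meas: "\<And>l. u l \<in> borel_measurable M"
    and u_01: "\<And>l \<omega> i. \<omega> \<in> space M \<Longrightarrow> u l \<omega> $ i \<in> {0, 1}"
    and u_prob: "\<And>l i. measure M {\<omega> \<in> space M. u l \<omega> $ i = 1} = p i"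
    and p_pos: "\<And>i. p i > 0"
    and e_meas: "\<And>l. strongly_measurable M (e l)"
    and e_in: "\<And>l \<omega>. \<omega> \<in> space M \<Longrightarrow> e l \<omega> \<in> direct_sum H"
    and nu: "\<nu> \<ge> 0"
    and e_int: "\<And>l. integrable M (\<lambda>\<omega>. (norm (e l \<omega>))\<^sup>2)"
    and e_bound: "\<And>l. (\<integral>\<omega>. (norm (e l \<omega>))\<^sup>2 \<partial>M) \<le> \<nu>\<^sup>2"
    and u_iid: "iid_process M borel u"
    and e_iid: "iid_process M borel e"
    and ue_indep: "indep_processes M borel u borel e"
    and x0_in: "x0 \<in> direct_sum H"
    and x_0: "\<And>\<omega>. \<omega> \<in> space M \<Longrightarrow> x 0 \<omega> = x0"
    and x_Suc: "\<And>l \<omega> i. \<omega> \<in> space M \<Longrightarrow>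
      x (Suc l) \<omega> $ i =
        (1 - u l \<omega> $ i) *\<^sub>R (x l \<omega> $ i) + (u l \<omega> $ i) *\<^sub>R (T (Suc l) (x l \<omega>) $ i + e l \<omega> $ i)"
  shows "let pmax = Max (range p); pmin = Min (range p);
             chi = sqrt (1 - pmin + pmin * \<zeta>\<^sup>2)
         in 0 < chi \<and> chi < 1 \<and>
            (\<forall>l. integrable M (\<lambda>\<omega>. norm (x l \<omega> - xbar l)) \<and>
               (\<integral>\<omega>. norm (x l \<omega> - xbar l) \<partial>M) \<le>
                 sqrt (pmax / pmin) *
                   (chi ^ l * norm (x0 - xbar 0) + (1 - chi ^ l) / (1 - chi) * (chi * \<sigma> + \<nu>)))"
proof -
  interpret prob_space M by (rule prob)

  \<comment> \<open>Extreme probabilities and the contraction factor\<close>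
  define m where "m = Min (range p)"
  define m' where "m' = Max (range p)"
  define chi where "chi = sqrt (1 - m + m * \<zeta>\<^sup>2)"
  have m: "m > 0" "\<And>i. m \<le> p i" and m': "\<And>i. p i \<le> m'"
    unfolding m_def m'_def using p_pos by auto
  have p1: "p i \<le> 1" for i
    using prob_le_1 u_prob[of 0 i] by metis
  have m1: "m \<le> 1"
    using m(2) p1 by (meson order_trans)
  have m'0: "m' > 0"
    using p_pos m' by (meson less_le_trans)
  have \<zeta>: "0 < \<zeta>" "\<zeta> < 1" and TH: "\<And>l y. y \<in> direct_sum H \<Longrightarrow> T l y \<in> direct_sum H"
    and Tc: "\<And>l y z. y \<in> direct_sum H \<Longrightarrow> z \<in> direct_sum H \<Longrightarrow> norm (T l y - T l z) \<le> \<zeta> * norm (y - z)"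
    using contr unfolding contractive_def by auto
  have \<zeta>_sq: "0 < 1 - \<zeta>\<^sup>2" "1 - \<zeta>\<^sup>2 < 1"
    using \<zeta> by (auto simp: power_less_one_iff abs_square_less_1)
  \<comment> \<open>The radicand of \<open>chi\<close> is
    \<open>1 - m * (1 - \<zeta>\<^sup>2)\<close>. It stays positive even for \<open>m = 1\<close>,
    because \<open>\<zeta>\<close> is positive.\<close>
  have "m * (1 - \<zeta>\<^sup>2) \<le> 1 * (1 - \<zeta>\<^sup>2)"
    using m1 \<zeta>_sq by (intro mult_right_mono) auto
  then have m_lt: "m * (1 - \<zeta>\<^sup>2) < 1"
    using \<zeta>_sq(2) unfolding mult_1 by (rule le_less_trans)
  have "1 - m + m * \<zeta>\<^sup>2 = 1 - m * (1 - \<zeta>\<^sup>2)"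
    by (simp add: algebra_simps)
  then have "0 < 1 - m + m * \<zeta>\<^sup>2 \<and> 1 - m + m * \<zeta>\<^sup>2 < 1"
    using m_lt mult_pos_pos[OF m(1) \<zeta>_sq(1)] by (simp only: diff_gt_0_iff_gt diff_less_eq less_add_same_cancel1 simp_thms)
  then have chi: "0 < chi" "chi < 1" "chi\<^sup>2 = 1 - m + m * \<zeta>\<^sup>2"
    by (auto simp: chi_def)

  \<comment> \<open>Update events and the sigma-algebras independent of them\<close>
  define U where "U i = {y :: real ^ 'n. y $ i = 1}" for i
  have U: "U i \<in> sets borel" for i
    unfolding U_def by measurable
  define A where "A l i = u l -` U i \<inter> space M" for l i
  have A: "A l i = {\<omega> \<in> space M. u l \<omega> $ i = 1}" for l i
    by (auto simp: A_def U_def)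
  have A_ev: "A l i \<in> events" for l i
    unfolding A_def using u_meas U by (rule measurable_sets)
  have A_prob: "prob (A l i) = p i" for l i
    unfolding A by (rule u_prob)

  have e_borel: "e l \<in> borel_measurable M" for l
    by (rule strongly_measurable_imp_borel[OF e_meas])
  have ind: "indep_set (sets (process_sigma M borel u)) (sets (process_sigma M borel e))"
    using ue_indep unfolding indep_processes_def .
  \<comment> \<open>\<open>P\<close> carries the noise alone and is used where the update identity
    is applied to \<open>e l\<close>.\<close>
  define P where "P = process_sigma M borel e"
  have P: "subalgebra M P"
    unfolding P_def subalgebra_def using indep_setD_ev2[OF ind] by simp
  have eP: "e l \<in> borel_measurable P" for l
    unfolding P_def by (rule measurable_process_sigma) (rule e_borel)
  have AP: "prob (A l i \<inter> B) = prob (A l i) * prob B" if "B \<in> sets P" for l i B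
    using that unfolding A P_def by (rule indep_setD[OF ind indicator_component_in_process[OF u_meas]])

  \<comment> \<open>\<open>G l\<close> contains all randomness that enters \<open>x l\<close>,
    namely the updates before time \<open>l\<close> and the noise, and is still independent of the
    updates at time \<open>l\<close>.\<close>
  define G where "G l = history M borel u borel e l" for l
  have iu: "indep_vars (\<lambda>_. borel) u UNIV"
    using u_iid unfolding iid_process_def by blast
  have G: "subalgebra M (G l)" for l
    unfolding G_def by (rule indep_history(1)[OF u_meas iu ue_indep U])
  have AG: "prob (A l i \<inter> B) = prob (A l i) * prob B" if "B \<in> sets (G l)" for l i B
    using that unfolding G_def A_def by (rule indep_history(2)[OF u_meas iu ue_indep U])
  have spG: "space (G l) = space M" for l
    by (simp add: G_def)
  have eG: "discretizable (G l) (e k)" for l k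
  proof (rule strongly_measurable_imp_discretizable[OF e_meas _ spG])
    have "subalgebra (G l) P"
      unfolding subalgebra_def G_def P_def using process_sigma_le_history by simp
    then show "e k \<in> borel_measurable (G l)"
      using eP by (rule measurable_from_subalg)
  qed
  have uG: "u k \<in> borel_measurable (G l)" if "k < l" for k l
  proof (rule measurable_from_subalg)
    show "subalgebra (G l) (past M borel u l)"
      unfolding subalgebra_def G_def using past_le_history by simp
    show "u k \<in> borel_measurable (past M borel u l)"
      using that by (intro measurable_past u_meas)
  qed

  \<comment> \<open>The iterates stay in the direct sum and are measurable for the history\<close>
  have subH: "subspace (H i)" for i
    using hilbert unfolding hilbert_subspace_def by blast
  \<comment> \<open>As \<open>u\<close> takes the values \<open>0\<close> and \<open>1\<close> only,
    the convex combination is a choice between two values.\<close>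
  have x_eq: "x (Suc l) \<omega> $ i = (if \<omega> \<in> A l i then T (Suc l) (x l \<omega>) $ i + e l \<omega> $ i else x l \<omega> $ i)"
    if "\<omega> \<in> space M" for l \<omega> i
    using x_Suc[OF that, of l i] u_01[OF that, of l i] that by (auto simp: A)
  have xH: "x l \<omega> \<in> direct_sum H" if w: "\<omega> \<in> space M" for l \<omega>
  proof (induction l)
    case (Suc l)
    with TH[of "x l \<omega>" "Suc l"] e_in[OF w, of l] show ?case
      using subspace_add[OF subH] unfolding direct_sum_def by (auto simp: x_eq[OF w])
  qed (simp add: x_0 w x0_in)
  have comp: "discretizable N (\<lambda>\<omega>. f \<omega> $ i)" if "discretizable N f" for N and f :: "'w \<Rightarrow> 'a ^ 'n" and i
  proof (rule discretizable_uniformly_continuous[OF that])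
    show "f \<in> space N \<rightarrow> UNIV" by simp
    show "uniformly_continuous_on UNIV (\<lambda>v :: 'a ^ 'n. v $ i)"
      by (rule bounded_linear.uniformly_continuous_on[OF bounded_linear_vec_nth uniformly_continuous_on_id])
  qed
  have Tx: "discretizable N (\<lambda>\<omega>. T j (f \<omega>))"
    if f: "discretizable N f" "f \<in> space N \<rightarrow> direct_sum H" for N j and f :: "'w \<Rightarrow> 'a ^ 'n"
  proof (rule discretizable_uniformly_continuous[OF f])
    show "uniformly_continuous_on (direct_sum H) (T j)"
      unfolding uniformly_continuous_on_def
    \<comment> \<open>Since \<open>\<zeta> < 1\<close>, \<open>\<epsilon>\<close> itself serves as
      modulus of continuity.\<close>
    proof (intro allI impI exI conjI ballI)
      fix \<epsilon> :: real and y z assume "\<epsilon> > 0" and yz: "y \<in> direct_sum H" "z \<in> direct_sum H" "dist z y < \<epsilon>"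
      have "norm (T j z - T j y) \<le> \<zeta> * norm (z - y)" by (rule Tc[OF yz(2,1)])
      also have "\<dots> \<le> 1 * norm (z - y)" using \<zeta> by (intro mult_right_mono) auto
      finally show "dist (T j z) (T j y) < \<epsilon>" using yz(3) by (simp add: dist_norm)
    qed
  qed
  \<comment> \<open>The sigma-algebra \<open>G l\<close> is kept fixed while \<open>k\<close> runs
    up to \<open>l\<close>: the step to \<open>Suc k\<close> uses \<open>u k\<close> with
    \<open>k < l\<close>, so the case \<open>k = l\<close> is still covered.\<close>
  have xG: "discretizable (G l) (x k)" if "k \<le> l" for k l
    using that
  proof (induction k)
    case 0
    show ?case
      by (rule discretizable_cong[OF discretizable_const[of _ x0]]) (simp add: spG x_0)
  next
    case (Suc k)
    then have x: "discretizable (G l) (x k)" by simp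
    have "x k \<in> space (G l) \<rightarrow> direct_sum H" using xH by (simp add: spG)
    note Tx = Tx[OF x this, of "Suc k"]
    show ?case
    proof (rule discretizable_vec)
      fix i
      have [measurable]: "u k \<in> borel_measurable (G l)" using uG Suc by simp
      have "Measurable.pred (G l) (\<lambda>\<omega>. u k \<omega> $ i = 1)" by measurable
      from discretizable_if[OF discretizable_add[OF comp[OF Tx] comp[OF eG[of l k]]] comp[OF x] this]
      show "discretizable (G l) (\<lambda>\<omega>. x (Suc k) \<omega> $ i)"
        by (rule discretizable_cong) (simp add: spG x_eq A)
    qed
  qed
  have diffG: "(\<lambda>\<omega>. f \<omega> - c) \<in> borel_measurable (G l)"
    if "discretizable (G l) f" for f :: "'w \<Rightarrow> 'a ^ 'n" and c l
  proof (rule discretizable_imp_borel)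
    show "discretizable (G l) (\<lambda>\<omega>. f \<omega> - c)"
      using discretizable_add[OF that discretizable_const[of _ "- c"]] by simp
  qed
  have wM: "(\<lambda>\<omega>. wnorm p (x l \<omega> - c)) \<in> borel_measurable M" for l c
    by (rule borel_measurable_continuous_on[OF continuous_wnorm])
      (rule measurable_from_subalg[OF G diffG[OF xG[OF order_refl]]])

  \<comment> \<open>Second moment of the masked noise\<close>
  have noise: "integrable M (\<lambda>\<omega>. (wnorm p (\<chi> i. if \<omega> \<in> A l i then e l \<omega> $ i else 0))\<^sup>2)"
    "expectation (\<lambda>\<omega>. (wnorm p (\<chi> i. if \<omega> \<in> A l i then e l \<omega> $ i else 0))\<^sup>2) \<le> \<nu>\<^sup>2" for l
  proof -
    note upd = expectation_wnorm_update[where d = "\<lambda>_. 0" and t = "e l" and p = p and A = "A l"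
      and z = "\<lambda>\<omega>. \<chi> i. if \<omega> \<in> A l i then e l \<omega> $ i else 0",
      OF p_pos A_ev A_prob P AP _ eP _ e_int]
    show "integrable M (\<lambda>\<omega>. (wnorm p (\<chi> i. if \<omega> \<in> A l i then e l \<omega> $ i else 0))\<^sup>2)"
      by (rule upd(1)) simp_all
    have "expectation (\<lambda>\<omega>. (wnorm p (\<chi> i. if \<omega> \<in> A l i then e l \<omega> $ i else 0))\<^sup>2)
      = expectation (\<lambda>\<omega>. (wnorm p (0 :: 'a ^ 'n))\<^sup>2) - expectation (\<lambda>\<omega>. (norm (0 :: 'a ^ 'n))\<^sup>2) + expectation (\<lambda>\<omega>. (norm (e l \<omega>))\<^sup>2)"
      by (rule upd(2)) simp_all
    also have "\<dots> \<le> \<nu>\<^sup>2"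
      using e_bound[of l] by (simp add: wnorm_sq[where p = p, OF p_pos])
    finally show "expectation (\<lambda>\<omega>. (wnorm p (\<chi> i. if \<omega> \<in> A l i then e l \<omega> $ i else 0))\<^sup>2) \<le> \<nu>\<^sup>2" .
  qed

  \<comment> \<open>One step of the error recursion\<close>
  define s where "s = \<sigma> / sqrt m"
  have s: "s \<ge> 0" using sigma m by (simp add: s_def)
  \<comment> \<open>The reference point first moves from \<open>xbar l\<close> to the fixed point
    \<open>xbar (Suc l)\<close> of the operator about to be applied, at cost \<open>s\<close>.
    Contraction by \<open>chi\<close> comes next and the noise last, which is why \<open>chi\<close>
    multiplies the drift but not \<open>\<nu>\<close>.\<close>
  have step: "integrable M (\<lambda>\<omega>. (wnorm p (x (Suc l) \<omega> - xbar (Suc l)))\<^sup>2) \<and>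
      expectation (\<lambda>\<omega>. (wnorm p (x (Suc l) \<omega> - xbar (Suc l)))\<^sup>2) \<le> (chi * (a + s) + \<nu>)\<^sup>2"
    if a: "a \<ge> 0" and i: "integrable M (\<lambda>\<omega>. (wnorm p (x l \<omega> - xbar l))\<^sup>2)"
      and b: "expectation (\<lambda>\<omega>. (wnorm p (x l \<omega> - xbar l))\<^sup>2) \<le> a\<^sup>2" for a l
  proof -
    \<comment> \<open>The new error splits as \<open>?z + ?r\<close>: \<open>?z\<close> is the
      update of \<open>?d\<close> towards \<open>?t\<close> without noise, and \<open>?r\<close> is
      the noise on the updated coordinates.\<close>
    let ?d = "\<lambda>\<omega>. x l \<omega> - xbar (Suc l)" and ?t = "\<lambda>\<omega>. T (Suc l) (x l \<omega>) - xbar (Suc l)"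
    let ?z = "\<lambda>\<omega>. \<chi> i. if \<omega> \<in> A l i then ?t \<omega> $ i else ?d \<omega> $ i"
    let ?r = "\<lambda>\<omega>. \<chi> i. if \<omega> \<in> A l i then e l \<omega> $ i else 0"
    have s': "wnorm p (xbar l - xbar (Suc l)) \<le> s"
    proof -
      have "wnorm p (xbar l - xbar (Suc l)) \<le> norm (xbar l - xbar (Suc l)) / sqrt m"
        by (rule wnorm_le[OF p_pos m])
      also have "\<dots> \<le> s"
        unfolding s_def using drift[of "Suc l"] m by (intro divide_right_mono) (auto simp: norm_minus_commute)
      finally show ?thesis .
    qed
    have tri: "\<bar>wnorm p (?d \<omega>)\<bar> \<le> wnorm p (x l \<omega> - xbar l) + s" for \<omega>
      using wnorm_triangle[of p "x l \<omega> - xbar l" "xbar l - xbar (Suc l)"] s' by simp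
    have d: "integrable M (\<lambda>\<omega>. (wnorm p (?d \<omega>))\<^sup>2)" "expectation (\<lambda>\<omega>. (wnorm p (?d \<omega>))\<^sup>2) \<le> (a + s)\<^sup>2"
      \<comment> \<open>The drift enters as the constant function \<open>s\<close>, whose second
        moment under a probability measure is its square.\<close>
      using L2_triangle_sq[OF wM _ wM i _ b a _ s tri] by (auto simp: prob_space)
    have td: "norm (?t \<omega>) \<le> \<zeta> * norm (?d \<omega>)" if "\<omega> \<in> space M" for \<omega>
      using Tc[OF xH[OF that] xbar_in, of "Suc l" l "Suc l"] xbar_fix[of "Suc l"] by simp
    have tG: "?t \<in> borel_measurable (G l)"
      by (rule diffG[OF Tx[OF xG[OF order_refl]]]) (simp add: spG xH)
    note con = expectation_wnorm_contraction[where d = ?d and t = ?t and z = ?z and p = p and A = "A l",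
      OF p_pos A_ev A_prob G AG diffG[OF xG[OF order_refl]] tG d(1) _ td \<zeta> m]
    have zi: "integrable M (\<lambda>\<omega>. (wnorm p (?z \<omega>))\<^sup>2)"
      by (rule con(1)) simp_all
    have "expectation (\<lambda>\<omega>. (wnorm p (?z \<omega>))\<^sup>2) \<le> (1 - m + m * \<zeta>\<^sup>2) * expectation (\<lambda>\<omega>. (wnorm p (?d \<omega>))\<^sup>2)"
      by (rule con(2)) simp_all
    also have "\<dots> \<le> chi\<^sup>2 * (a + s)\<^sup>2"
      unfolding chi(3)[symmetric] using d(2) by (intro mult_left_mono) auto
    finally have ze: "expectation (\<lambda>\<omega>. (wnorm p (?z \<omega>))\<^sup>2) \<le> (chi * (a + s))\<^sup>2"
      by (simp add: power_mult_distrib)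
    have tri2: "\<bar>wnorm p (x (Suc l) \<omega> - xbar (Suc l))\<bar> \<le> wnorm p (?z \<omega>) + wnorm p (?r \<omega>)"
      if "\<omega> \<in> space M" for \<omega>
    proof -
      have "x (Suc l) \<omega> - xbar (Suc l) = ?z \<omega> + ?r \<omega>"
        by (simp add: vec_eq_iff x_eq[OF that])
      then show ?thesis using wnorm_triangle[of p "?z \<omega>" "?r \<omega>"] by simp
    qed
    have "chi * (a + s) \<ge> 0" using chi a s by simp
    \<comment> \<open>Minkowski's inequality tolerates the dependence between \<open>?z\<close> and
      \<open>?r\<close>, which are masked by the same events \<open>A l i\<close>.\<close>
    from L2_triangle_sq[OF wnorm_sq_integrable_imp_measurable[OF zi]
        wnorm_sq_integrable_imp_measurable[OF noise(1)] wM zi noise(1) ze this noise(2) nu tri2]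
    show ?thesis by blast
  qed

  \<comment> \<open>Solving the recursion and returning to the original norm\<close>
  define a where "a = rec_nat (norm (x0 - xbar 0) / sqrt m) (\<lambda>_ r. chi * (r + s) + \<nu>)"
  have a0: "a 0 = norm (x0 - xbar 0) / sqrt m" and aS: "\<And>l. a (Suc l) = chi * (a l + s) + \<nu>"
    by (simp_all add: a_def)
  have a_nonneg: "a l \<ge> 0" for l
    by (induction l) (use m s chi nu in \<open>auto simp: a0 aS\<close>)
  have main: "integrable M (\<lambda>\<omega>. (wnorm p (x l \<omega> - xbar l))\<^sup>2) \<and>
      expectation (\<lambda>\<omega>. (wnorm p (x l \<omega> - xbar l))\<^sup>2) \<le> (a l)\<^sup>2" for l
  proof (induction l)
    case 0
    have "(wnorm p (x0 - xbar 0))\<^sup>2 \<le> (a 0)\<^sup>2"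
      unfolding a0 using wnorm_le[OF p_pos m] by (intro power_mono) auto
    moreover have "integrable M (\<lambda>\<omega>. (wnorm p (x 0 \<omega> - xbar 0))\<^sup>2) \<longleftrightarrow> integrable M (\<lambda>\<omega>. (wnorm p (x0 - xbar 0))\<^sup>2)"
      by (rule Bochner_Integration.integrable_cong) (auto simp: x_0)
    moreover have "expectation (\<lambda>\<omega>. (wnorm p (x 0 \<omega> - xbar 0))\<^sup>2) = expectation (\<lambda>\<omega>. (wnorm p (x0 - xbar 0))\<^sup>2)"
      by (rule Bochner_Integration.integral_cong) (auto simp: x_0)
    ultimately show ?case by (simp add: prob_space)
  next
    case (Suc l)
    then show ?case using step[OF a_nonneg] unfolding aS by blast
  qed
  have final: "integrable M (\<lambda>\<omega>. norm (x l \<omega> - xbar l)) \<and> expectation (\<lambda>\<omega>. norm (x l \<omega> - xbar l)) \<le>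
      sqrt (m' / m) * (chi ^ l * norm (x0 - xbar 0) + (1 - chi ^ l) / (1 - chi) * (chi * \<sigma> + \<nu>))" for l
  proof
    \<comment> \<open>Jensen's inequality turns the second moment bound into one for the first
      moment; the weights are then removed at the cost of \<open>sqrt m'\<close>.\<close>
    have w: "integrable M (\<lambda>\<omega>. wnorm p (x l \<omega> - xbar l))" "expectation (\<lambda>\<omega>. wnorm p (x l \<omega> - xbar l)) \<le> a l"
      using expectation_le_sqrt[OF wM _ _ a_nonneg] main by blast+
    have le: "norm (x l \<omega> - xbar l) \<le> sqrt m' * wnorm p (x l \<omega> - xbar l)" for \<omega>
      by (rule norm_le_wnorm[OF p_pos m'])
    have nM: "(\<lambda>\<omega>. norm (x l \<omega> - xbar l)) \<in> borel_measurable M"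
      by (rule borel_measurable_continuous_on[OF _ measurable_from_subalg[OF G diffG[OF xG[OF order_refl]]]])
        (rule continuous_on_norm_id)
    show ni: "integrable M (\<lambda>\<omega>. norm (x l \<omega> - xbar l))"
      by (rule Bochner_Integration.integrable_bound[OF integrable_mult_right[OF w(1), of "sqrt m'"] nM])
        (use le in \<open>auto simp: abs_mult m'0 less_imp_le\<close>)
    have "expectation (\<lambda>\<omega>. norm (x l \<omega> - xbar l)) \<le> expectation (\<lambda>\<omega>. sqrt m' * wnorm p (x l \<omega> - xbar l))"
      using ni w(1) le by (intro integral_mono) auto
    also have "\<dots> \<le> sqrt m' * a l"
      using w(2) m'0 by (simp add: mult_left_mono)
    also have "a l = chi ^ l * (norm (x0 - xbar 0) / sqrt m) + (1 - chi ^ l) / (1 - chi) * (chi * s + \<nu>)"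
      by (rule affine_recurrence_closed_form) (use chi in \<open>auto simp: a0 aS algebra_simps\<close>)
    also have "\<dots> \<le> chi ^ l * (norm (x0 - xbar 0) / sqrt m) + (1 - chi ^ l) / (1 - chi) * ((chi * \<sigma> + \<nu>) / sqrt m)"
    proof (intro add_left_mono mult_left_mono)
      \<comment> \<open>As \<open>m \<le> 1\<close>, the noise term may be enlarged by the factor
        \<open>1 / sqrt m\<close> that the other terms already carry; this common factor then merges
        with \<open>sqrt m'\<close>.\<close>
      have "\<nu> * sqrt m \<le> \<nu> * 1" using nu m m1 by (intro mult_left_mono) auto
      then have "\<nu> \<le> \<nu> / sqrt m" using m by (simp add: field_simps)
      then show "chi * s + \<nu> \<le> (chi * \<sigma> + \<nu>) / sqrt m" by (simp add: s_def add_divide_distrib)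
      show "0 \<le> (1 - chi ^ l) / (1 - chi)"
        using chi by (simp add: power_le_one)
    qed
    also have "sqrt m' * \<dots> = sqrt (m' / m) * (chi ^ l * norm (x0 - xbar 0) + (1 - chi ^ l) / (1 - chi) * (chi * \<sigma> + \<nu>))"
    proof -
      have "r * (c * (n / b) + g * (k / b)) = r / b * (c * n + g * k)" for r c n b g k :: real
        by (simp add: add_divide_distrib distrib_left)
      then show ?thesis unfolding real_sqrt_divide .
    qed
    finally show "expectation (\<lambda>\<omega>. norm (x l \<omega> - xbar l)) \<le>
      sqrt (m' / m) * (chi ^ l * norm (x0 - xbar 0) + (1 - chi ^ l) / (1 - chi) * (chi * \<sigma> + \<nu>))"
      using m'0 by (simp add: mult_left_mono)
  qed
  show ?thesis
    unfolding Let_def m_def[symmetric] m'_def[symmetric] chi_def[symmetric]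
    using chi final by blast
qed

end
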